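(* For all but finitely many pairs of integers $(k,n)$ with $1<k<n$, the following holds: if $A$ is a set of $n$ positive integers with $d_k(A)\ge\binom{n-1}{k}$, then $A$ is a $k$-anti-pencil.
   Context: For a finite set $X$ of positive integers, write $\sum X=\sum_{x\in X}x$. Let $A$ be a set of $n$ positive integers with elements $a_1<a_2<\cdots<a_n$. A subset $B\subseteq A$ is a divisor of $A$ if $\sum B\mid\sum A$. The number of $k$-element subsets of $A$ that are divisors of $A$ is denoted $d_k(A)$. The set $A$ is called a $k$-anti-pencil if the set of $k$-element subsets of $A$ that are divisors of $A$ is exactly $\binom{A\setminus\{a_n\}}{k}$, the set of all $k$-element subsets of $A\setminus\{a_n\}$, where $a_n$ is the largest element of $A$. *)

theory Defs
  imports Complex_Main "HOL-Library.Ramsey"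
begin

definition is_divisor :: "nat set \<Rightarrow> nat set \<Rightarrow> bool" where
  "is_divisor B A \<longleftrightarrow> B \<subseteq> A \<and> \<Sum>B dvd \<Sum>A"

definition k_divisors :: "nat \<Rightarrow> nat set \<Rightarrow> nat set set" where
  "k_divisors k A = {B \<in> nsets A k. is_divisor B A}"

definition num_k_divisors :: "nat \<Rightarrow> nat set \<Rightarrow> nat" where
  "num_k_divisors k A = card (k_divisors k A)"

(* Meaningful for finite nonempty A only; Max A is then the largest element. *)
definition anti_pencil :: "nat \<Rightarrow> nat set \<Rightarrow> bool" where
  "anti_pencil k A \<longleftrightarrow> k_divisors k A = nsets (A - {Max A}) k"

end

theory Submission
  imports Defs
begin

text \<open>
  Let \<open>n = card A\<close> and \<open>s = \<Sum>A\<close>. If the largest element is at least \<open>s / 2\<close>, no proper subset of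
  size \<open>k > 1\<close> containing it is a divisor, and the count forces an anti-pencil. Otherwise \<open>n\<close> is
  bounded, in three regimes.

  For \<open>n \<le> 20000 k\<close>, the second moment of \<open>\<Sum>(A - B)\<close> over all \<open>k\<close>-sets \<open>B\<close> shows that at most
  \<open>(1 - c) ((n - 1) choose k)\<close> of them have a sum below a small fraction of \<open>s\<close>, because no
  element carries more than half of the weight. The remaining divisors have one of boundedly many
  sums, and each sum is attained by at most \<open>n / ((n - k) (k + 1)) * ((n - 1) choose k)\<close> sets; so
  \<open>n - k\<close> is bounded.

  If \<open>l = n - k\<close> is bounded, the complement of a divisor has weight at least \<open>s / 2\<close>. Either it
  contains two of the at most \<open>6 l\<close> elements exceeding \<open>s / (6 l)\<close>, which is rare, or the divisor
  has sum exactly \<open>s / 2\<close>.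

  For \<open>20000 k < n\<close>, double counting gives a \<open>(k - 1)\<close>-set \<open>D\<close> that contains one of the largest
  elements \<open>x\<close> and that almost every \<open>y\<close> extends to a divisor. The integers \<open>s / (\<Sum>D + y)\<close> are
  distinct; comparing the extreme ones gives \<open>x \<le> s / (2 n)\<close> and \<open>w \<le> s / (4 n)\<close> for the elements
  \<open>w\<close> below the median, up to small errors. At most one element exceeds \<open>8 s / n\<close>, and it is below
  \<open>s / 2\<close>, so the elements sum to less than \<open>s\<close>.
\<close>

section \<open>Counting subsets of fixed size\<close>

lemma card_nsets_diff:
  assumes "finite A" "X \<subseteq> A"
  shows "card (nsets (A - X) k) = (card A - card X) choose k"
  using assms by (simp add: card_nsets card_Diff_subset finite_subset)

lemma nsets_diff: "nsets (A - X) k = {B \<in> nsets A k. B \<inter> X = {}}"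
  by (auto simp: nsets_def)

lemma card_nsets_containing:
  assumes "finite A" "x \<in> A" "0 < k"
  shows "card {B \<in> nsets A k. x \<in> B} = (card A - 1) choose (k - 1)"
proof -
  have "card A > 0" using assms by (auto simp: card_gt_0_iff)
  have "{B \<in> nsets A k. x \<in> B} = nsets A k - nsets (A - {x}) k"
    by (auto simp: nsets_diff)
  moreover have "card (nsets A k - nsets (A - {x}) k) = card (nsets A k) - card (nsets (A - {x}) k)"
    using assms(1) by (intro card_Diff_subset finite_imp_finite_nsets nsets_mono) auto
  moreover have "card A choose k = ((card A - 1) choose (k - 1)) + ((card A - 1) choose k)"
    using \<open>card A > 0\<close> \<open>0 < k\<close> by (rule choose_reduce_nat)
  moreover have "card (nsets (A - {x}) k) = (card A - 1) choose k"
    using card_nsets_diff[of A "{x}" k] assms by simp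
  ultimately show ?thesis by simp
qed

text \<open>Two \<open>k\<close>-sets with the same sum that extend to the same \<open>(k+1)\<close>-set are equal, since
  the added element is the difference of the sums.\<close>

lemma card_nsets_sum_eq_le:
  fixes A :: "nat set"
  assumes "finite A" "k < card A"
  shows "card {B \<in> nsets A k. \<Sum>B = s} * ((card A - k) * (k + 1)) \<le> card A * ((card A - 1) choose k)"
proof -
  let ?F = "{B \<in> nsets A k. \<Sum>B = s}"
  let ?P = "Sigma ?F (\<lambda>B. A - B)"
  have fin: "finite ?F" using assms(1) by (simp add: finite_imp_finite_nsets)
  have "card ?P = (\<Sum>B\<in>?F. card (A - B))"
    using fin assms(1) by (intro card_SigmaI) auto
  also have "\<dots> = (\<Sum>B\<in>?F. card A - k)"
    by (rule sum.cong) (auto simp: nsets_def card_Diff_subset)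
  finally have P: "card ?P = card ?F * (card A - k)" by simp
  have "inj_on (\<lambda>(B, y). insert y B) ?P"
  proof (rule inj_onI, clarify)
    fix B y C z
    assume B: "B \<in> nsets A k" "s = \<Sum>B" and y: "y \<in> A" "y \<notin> B"
      and C: "C \<in> nsets A k" "\<Sum>C = \<Sum>B" and z: "z \<in> A" "z \<notin> C"
      and eq: "insert y B = insert z C"
    have "finite B" "finite C" using B C by (auto simp: nsets_def)
    then have "y + \<Sum>B = z + \<Sum>C" using y z eq by (metis sum.insert)
    then have "y = z" using C by simp
    moreover have "B = C" using eq \<open>y = z\<close> y z by (simp add: insert_ident)
    ultimately show "B = C \<and> y = z" by simp
  qed
  moreover have "(\<lambda>(B, y). insert y B) ` ?P \<subseteq> nsets A (k + 1)"
    by (auto simp: nsets_def)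
  ultimately have "card ?P \<le> card (nsets A (k + 1))"
    using assms(1) by (intro card_inj_on_le finite_imp_finite_nsets)
  then have "card ?F * (card A - k) \<le> card A choose (k + 1)"
    using P by (simp add: card_nsets)
  then have "card ?F * (card A - k) * (k + 1) \<le> (k + 1) * (card A choose (k + 1))"
    by (simp only: mult.commute[of "k + 1"] mult_le_mono1)
  also have "\<dots> = card A * ((card A - 1) choose k)"
    using binomial_absorption[of k "card A"] by simp
  finally show ?thesis by (simp only: mult.assoc)
qed

text \<open>Both sides count pairs (B, y) where B satisfies \<open>P\<close> and contains
  \<open>x\<close>, and y is one of the k - 1 elements of B - {x}. The left side reads such a pair
  as the set D = B - {y} together with its extension y.\<close>

lemma double_count_extensions:
  assumes "finite A" "x \<in> A" "0 < k"
  shows "(\<Sum>D\<in>{D \<in> nsets A (k - 1). x \<in> D}. card {y \<in> A - D. P (insert y D)})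
    = (k - 1) * card {B \<in> nsets A k. x \<in> B \<and> P B}"
proof -
  let ?F = "{D \<in> nsets A (k - 1). x \<in> D}" and ?G = "{B \<in> nsets A k. x \<in> B \<and> P B}"
  let ?S = "Sigma ?F (\<lambda>D. {y \<in> A - D. P (insert y D)})"
  let ?T = "Sigma ?G (\<lambda>B. B - {x})"
  have fin: "finite ?F" "finite ?G" using assms(1) by (simp_all add: finite_imp_finite_nsets)
  have "bij_betw (\<lambda>(D, y). (insert y D, y)) ?S ?T"
  proof (rule bij_betwI[where g = "\<lambda>(B, y). (B - {y}, y)"])
    show "(\<lambda>(D, y). (insert y D, y)) \<in> ?S \<rightarrow> ?T"
      using assms by (auto simp: nsets_def)
    show "(\<lambda>(B, y). (B - {y}, y)) \<in> ?T \<rightarrow> ?S"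
      using assms by (auto simp: nsets_def insert_absorb)
  qed (auto simp: insert_absorb)
  then have "card ?S = card ?T" by (rule bij_betw_same_card)
  moreover have "card ?S = (\<Sum>D\<in>?F. card {y \<in> A - D. P (insert y D)})"
    using fin assms(1) by (intro card_SigmaI) auto
  moreover have "card ?T = (\<Sum>B\<in>?G. card (B - {x}))"
    using fin by (intro card_SigmaI) (auto simp: nsets_def)
  moreover have "(\<Sum>B\<in>?G. card (B - {x})) = (\<Sum>B\<in>?G. k - 1)"
    by (rule sum.cong) (auto simp: nsets_def)
  ultimately show ?thesis by simp
qed

text \<open>Induction on \<open>u\<close>, moving the maximum of the remainder into
  \<open>U\<close>. It serves to cut \<open>A\<close> into layers by size.\<close>

lemma exists_top_subset:
  fixes A :: "'a :: linorder set"
  assumes "finite A" "u \<le> card A"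
  shows "\<exists>U\<subseteq>A. card U = u \<and> (\<forall>x\<in>U. \<forall>y\<in>A - U. y < x)"
  using assms(2)
proof (induction u)
  case 0
  then show ?case by (intro exI[of _ "{}"]) auto
next
  case (Suc u)
  then obtain U where U: "U \<subseteq> A" "card U = u" "\<forall>x\<in>U. \<forall>y\<in>A - U. y < x" by auto
  have finU: "finite U" using U assms(1) finite_subset by blast
  have ne: "A - U \<noteq> {}" using U Suc.prems finU by (metis Diff_eq_empty_iff card_mono not_less_eq_eq)
  define m where "m = Max (A - U)"
  have m: "m \<in> A - U" "\<And>y. y \<in> A - U \<Longrightarrow> y \<le> m"
    using ne assms(1) by (auto simp: m_def Max_in[of "A - U", simplified])
  show ?case
  proof (intro exI[of _ "insert m U"] conjI)
    show "insert m U \<subseteq> A" using m U by auto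
    show "card (insert m U) = Suc u" using m U finU by auto
    show "\<forall>x\<in>insert m U. \<forall>y\<in>A - insert m U. y < x"
      using m U by (auto simp: less_le)
  qed
qed

section \<open>Second moment\<close>

text \<open>After expanding the square, a pair (x, y) contributes x * y once for each
  \<open>B\<close> that avoids both: (n - 1) choose k times on the diagonal, (n - 2) choose k times
  off it. The \<open>Q\<close> term on the left keeps natural subtraction out of the
  identity.\<close>

lemma sum_nsets_complement_squares:
  fixes A :: "nat set"
  assumes "finite A"
  defines "n \<equiv> card A" and "Q \<equiv> (\<Sum>x\<in>A. x\<^sup>2)"
  shows "(\<Sum>B\<in>nsets A k. (\<Sum>(A - B))\<^sup>2) + Q * ((n - 2) choose k)
    = Q * ((n - 1) choose k) + (\<Sum>A)\<^sup>2 * ((n - 2) choose k)"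
proof -
  let ?N = "nsets A k"
  have fN: "finite ?N" using assms(1) by (simp add: finite_imp_finite_nsets)
  have pair: "card {B \<in> ?N. x \<notin> B \<and> y \<notin> B} = (if x = y then (n - 1) choose k else (n - 2) choose k)"
    if "x \<in> A" "y \<in> A" for x y
  proof -
    have "{B \<in> ?N. x \<notin> B \<and> y \<notin> B} = nsets (A - {x, y}) k" by (auto simp: nsets_diff)
    then show ?thesis using card_nsets_diff[of A "{x,y}" k] that assms(1) by (auto simp: n_def card_insert_if numeral_2_eq_2)
  qed
  have "(\<Sum>B\<in>?N. (\<Sum>(A - B))\<^sup>2) = (\<Sum>B\<in>?N. \<Sum>x\<in>A. \<Sum>y\<in>A. if x \<notin> B \<and> y \<notin> B then x * y else 0)"
  proof (rule sum.cong[OF refl])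
    fix B assume "B \<in> ?N"
    have e: "\<Sum>(A - B) = (\<Sum>x\<in>A. if x \<notin> B then x else 0)"
      using assms(1) by (simp add: sum.If_cases Diff_eq Collect_neg_eq)
    show "(\<Sum>(A - B))\<^sup>2 = (\<Sum>x\<in>A. \<Sum>y\<in>A. if x \<notin> B \<and> y \<notin> B then x * y else 0)"
      unfolding e power2_eq_square sum_product by (intro sum.cong) auto
  qed
  also have "\<dots> = (\<Sum>x\<in>A. \<Sum>B\<in>?N. \<Sum>y\<in>A. if x \<notin> B \<and> y \<notin> B then x * y else 0)"
    by (rule sum.swap)
  also have "\<dots> = (\<Sum>x\<in>A. \<Sum>y\<in>A. \<Sum>B\<in>?N. if x \<notin> B \<and> y \<notin> B then x * y else 0)"
    by (intro sum.cong refl sum.swap)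
  also have "\<dots> = (\<Sum>x\<in>A. \<Sum>y\<in>A. x * y * card {B \<in> ?N. x \<notin> B \<and> y \<notin> B})"
    using fN by (intro sum.cong refl) (simp add: sum.inter_filter[symmetric])
  also have "\<dots> = (\<Sum>x\<in>A. \<Sum>y\<in>A. x * y * (if x = y then (n - 1) choose k else (n - 2) choose k))"
    by (intro sum.cong refl) (simp add: pair)
  finally have 1: "(\<Sum>B\<in>?N. (\<Sum>(A - B))\<^sup>2) = \<dots>" .
  have 2: "Q * c = (\<Sum>x\<in>A. \<Sum>y\<in>A. if x = y then x * y * c else 0)" for c
    using assms(1) by (simp add: Q_def sum_distrib_right power2_eq_square)
  have 3: "(\<Sum>A)\<^sup>2 * ((n - 2) choose k) = (\<Sum>x\<in>A. \<Sum>y\<in>A. x * y * ((n - 2) choose k))"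
    by (simp only: power2_eq_square sum_product) (simp only: sum_distrib_right)
  show ?thesis
    unfolding 1 2 3 sum.distrib[symmetric] by (intro sum.cong refl) auto
qed

text \<open>A set of sum at most c * s leaves a complement of weight at least (1 - c) * s, so
  Markov's inequality applies to the squared complement weights. As no element exceeds s / 2, the
  sum of squares is at most s^2 / 2, and this gains the factor 1 - k / (2 (n - 1)).\<close>

lemma card_nsets_small_sum_le:
  fixes A :: "nat set" and c :: real
  assumes "finite A" "k < card A" "2 \<le> card A" "\<And>x. x \<in> A \<Longrightarrow> 2 * x \<le> \<Sum>A" "0 < \<Sum>A" "c \<le> 1"
  shows "card {B \<in> nsets A k. real (\<Sum>B) \<le> c * \<Sum>A} * (1 - c)\<^sup>2
    \<le> ((card A - 1) choose k) * (1 - k / (2 * (real (card A) - 1)))"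
proof -
  define n Q s where "n = card A" and "Q = (\<Sum>x\<in>A. x\<^sup>2)" and "s = \<Sum>A"
  let ?S = "{B \<in> nsets A k. real (\<Sum>B) \<le> c * s}"
  have fN: "finite (nsets A k)" using assms(1) by (simp add: finite_imp_finite_nsets)
  have "2 * Q \<le> s\<^sup>2"
  proof -
    have "2 * Q = (\<Sum>x\<in>A. (2 * x) * x)"
      by (simp add: Q_def sum_distrib_left power2_eq_square mult.assoc)
    also have "\<dots> \<le> (\<Sum>x\<in>A. s * x)" using assms(4) by (intro sum_mono mult_right_mono) (auto simp: s_def)
    also have "\<dots> = s\<^sup>2" by (simp add: sum_distrib_left[symmetric] power2_eq_square s_def)
    finally show ?thesis .
  qed
  then have Q: "2 * real Q \<le> (real s)\<^sup>2" by (metis of_nat_le_iff of_nat_mult of_nat_numeral of_nat_power)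
  \<comment> \<open>\<open>r\<close> is the ratio of (n - 2) choose k to (n - 1) choose k: the
    proportion of the \<open>k\<close>-sets avoiding one element that also avoid a second
    one.\<close>
  define r where "r = 1 - real k / (real n - 1)"
  define N where "N = real ((n - 1) choose k)"
  have n: "real n - 1 > 0" "k < n" using assms by (auto simp: n_def)
  have "r \<le> 1" using n by (simp add: r_def)
  have "(n - 1 - k) * ((n - 1) choose k) = (n - 1) * ((n - 2) choose k)"
    using binomial_absorb_comp[of "n - 1" k] by (simp add: numeral_2_eq_2)
  then have "real (n - 1 - k) * N = real (n - 1) * real ((n - 2) choose k)"
    unfolding N_def by (metis of_nat_mult)
  moreover have "real (n - 1 - k) = real n - 1 - real k" "real (n - 1) = real n - 1" using n by auto
  ultimately have N2: "real ((n - 2) choose k) = N * r"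
    using n by (simp add: r_def field_simps)
  have "card ?S * ((1 - c) * s)\<^sup>2 = (\<Sum>B\<in>?S. ((1 - c) * s)\<^sup>2)" by simp
  also have "\<dots> \<le> (\<Sum>B\<in>?S. real ((\<Sum>(A - B))\<^sup>2))"
  proof (rule sum_mono)
    fix B assume B: "B \<in> ?S"
    then have "B \<subseteq> A" by (auto simp: nsets_def)
    then have "real (\<Sum>(A - B)) + real (\<Sum>B) = s"
      using assms(1) by (metis s_def of_nat_add sum.subset_diff)
    then have "(1 - c) * s \<le> real (\<Sum>(A - B))" using B by (simp add: algebra_simps)
    moreover have "0 \<le> (1 - c) * s" using assms by simp
    ultimately show "((1 - c) * s)\<^sup>2 \<le> real ((\<Sum>(A - B))\<^sup>2)"
      by (metis of_nat_power power_mono)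
  qed
  also have "\<dots> \<le> (\<Sum>B\<in>nsets A k. real ((\<Sum>(A - B))\<^sup>2))"
    using fN by (intro sum_mono2) auto
  also have "\<dots> = Q * N + ((real s)\<^sup>2 - real Q) * (N * r)"
  proof -
    have "real ((\<Sum>B\<in>nsets A k. (\<Sum>(A - B))\<^sup>2) + Q * ((n - 2) choose k))
      = real (Q * ((n - 1) choose k) + s\<^sup>2 * ((n - 2) choose k))"
      using sum_nsets_complement_squares[OF assms(1), of k] by (simp add: n_def Q_def s_def)
    then show ?thesis by (simp add: N2 N_def algebra_simps del: of_nat_sum)(simp add: algebra_simps)
  qed
  also have "\<dots> = N * ((real s)\<^sup>2 * r + Q * (1 - r))" by (simp add: algebra_simps)
  also have "\<dots> \<le> N * ((real s)\<^sup>2 * r + ((real s)\<^sup>2 / 2) * (1 - r))"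
    using Q \<open>r \<le> 1\<close> by (intro mult_left_mono add_left_mono mult_right_mono) (auto simp: N_def)
  also have "\<dots> = N * (1 - k / (2 * (real n - 1))) * (real s)\<^sup>2"
  proof -
    have e: "k / (2 * (real n - 1)) = (1 - r) / 2" by (simp add: r_def)
    show ?thesis unfolding e by (simp add: algebra_simps)
  qed
  finally have "card ?S * (1 - c)\<^sup>2 * (real s)\<^sup>2 \<le> N * (1 - k / (2 * (real n - 1))) * (real s)\<^sup>2"
    by (simp add: power_mult_distrib mult.assoc)
  moreover have "(real s)\<^sup>2 > 0" using assms(5) by (simp add: s_def del: of_nat_sum)
  ultimately show ?thesis by (simp add: n_def s_def N_def)
qed

section \<open>Sums that divide a common number\<close>

lemma card_nat_interval_le:
  fixes p q :: real
  assumes "finite M" "M \<noteq> {}" "\<And>m. m \<in> M \<Longrightarrow> p \<le> real m \<and> real m \<le> q"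
  shows "card M \<le> q - p + 1"
proof -
  have mm: "Min M \<in> M" "Max M \<in> M" "Min M \<le> Max M" using assms by (auto simp: Min_le)
  have "M \<subseteq> {Min M..Max M}" using assms(1) by auto
  then have "card M \<le> Suc (Max M) - Min M" by (metis card_atLeastAtMost card_mono finite_atLeastAtMost)
  then have "card M + Min M \<le> Max M + 1" using mm(3) by linarith
  then have "real (card M) + real (Min M) \<le> real (Max M) + 1"
    by (metis of_nat_1 of_nat_add of_nat_le_iff)
  moreover have "p \<le> real (Min M)" "real (Max M) \<le> q" using assms(3) mm by auto
  ultimately show ?thesis by linarith
qed

text \<open>The quotients \<open>s / (c + y)\<close> are distinct integers, so they span a range of length at
  least \<open>card Y - 1\<close>.\<close>

lemma card_shifted_divisors_le:
  fixes Y :: "nat set" and s c :: nat and p q :: real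
  assumes "finite Y" "Y \<noteq> {}" "0 < s" "\<And>y. y \<in> Y \<Longrightarrow> (c + y) dvd s"
    "\<And>y. y \<in> Y \<Longrightarrow> p \<le> s / (c + y) \<and> s / (c + y) \<le> q"
  shows "card Y \<le> q - p + 1"
proof -
  let ?m = "\<lambda>y. s div (c + y)"
  have r: "real (?m y) = s / (c + y)" if "y \<in> Y" for y
    using assms(4)[OF that] by (rule real_of_nat_div)
  have "inj_on ?m Y"
  proof (rule inj_onI)
    fix y z assume yz: "y \<in> Y" "z \<in> Y" "?m y = ?m z"
    have e: "(c + y) * ?m y = s" "(c + z) * ?m z = s" using assms(4)[OF yz(1)] assms(4)[OF yz(2)] by (simp_all only: dvd_mult_div_cancel)
    then have "?m y > 0" using assms(3) by (intro Nat.gr0I) auto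
    then show "y = z" using e yz(3) by (metis add_left_cancel mult_cancel2 not_less0)
  qed
  then have "card (?m ` Y) = card Y" by (rule card_image)
  moreover have "card (?m ` Y) \<le> q - p + 1"
  proof (rule card_nat_interval_le)
    fix m assume "m \<in> ?m ` Y"
    then show "p \<le> real m \<and> real m \<le> q" using assms(5) r by auto
  qed (use assms in auto)
  ultimately show ?thesis by simp
qed

text \<open>The quotients s / (c + y) lie between 1 and s / c.\<close>

lemma shifted_divisors_count:
  fixes Y :: "nat set" and s c :: nat
  assumes "finite Y" "0 < c" "0 < s" "\<And>y. y \<in> Y \<Longrightarrow> (c + y) dvd s"
  shows "card Y * c \<le> s"
proof (cases "Y = {}")
  case False
  have "card Y \<le> real s / c - 1 + 1"
  proof (rule card_shifted_divisors_le[OF assms(1) False assms(3,4)])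
    fix y assume "y \<in> Y"
    then have "c + y \<le> s" using assms by (intro dvd_imp_le) auto
    then have "1 \<le> s / (c + y)" using assms(2) by (simp add: field_simps flip: of_nat_add)
    moreover have "s / (c + y) \<le> s / c" using assms(2) by (intro divide_left_mono) auto
    ultimately show "1 \<le> s / (c + y) \<and> s / (c + y) \<le> s / c" by simp
  qed
  then have "real (card Y) * real c \<le> real s" using assms(2) by (simp add: field_simps)
  then show ?thesis by (metis of_nat_le_iff of_nat_mult)
qed simp

text \<open>The quotients lie between s / (c + x) and s / (c + w). The length of this interval
  decreases in \<open>c\<close>, so c = x is the worst case.\<close>

lemma shifted_divisors_spread:
  fixes Y :: "nat set" and s c x w :: nat
  assumes "finite Y" "Y \<noteq> {}" "0 < s" "0 < x" "x \<le> c"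
    and dvd: "\<And>y. y \<in> Y \<Longrightarrow> (c + y) dvd s" and Y: "\<And>y. y \<in> Y \<Longrightarrow> w < y \<and> y < x"
  shows "2 * real x * (x + w) * (real (card Y) - 1) \<le> real s * (real x - w)"
proof -
  have wx: "w < x" using assms(2) Y by fastforce
  have "card Y \<le> s / (c + w) - s / (c + x) + 1"
  proof (rule card_shifted_divisors_le[OF assms(1-3) dvd])
    fix y assume "y \<in> Y"
    then show "s / (c + x) \<le> s / (c + y) \<and> s / (c + y) \<le> s / (c + w)"
      using Y[of y] assms(4,5) by (auto intro!: divide_left_mono mult_pos_pos)
  qed auto
  also have "s / (c + w) - s / (c + x) = s * (real x - w) / ((real c + w) * (real c + x))"
    using assms(4,5) by (simp add: divide_simps) (simp add: algebra_simps)
  also have "\<dots> \<le> s * (real x - w) / ((real x + w) * (2 * real x))"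
    using assms(4,5) wx by (intro divide_left_mono mult_mono mult_nonneg_nonneg mult_pos_pos) auto
  finally have "real (card Y) - 1 \<le> s * (real x - w) / ((real x + w) * (2 * real x))" by simp
  moreover have "(real x + w) * (2 * real x) > 0" using assms(4) by simp
  ultimately have "(real (card Y) - 1) * ((real x + w) * (2 * real x)) \<le> s * (real x - w)"
    by (simp add: pos_le_divide_eq)
  then show ?thesis by (simp add: mult_ac)
qed

text \<open>The case w = 0 of the spread bound, with a factor \<open>x\<close> cancelled.\<close>

lemma shifted_divisors_upper:
  fixes Y :: "nat set" and s c x :: nat
  assumes "finite Y" "Y \<noteq> {}" "0 < s" "0 < x" "x \<le> c"
    and "\<And>y. y \<in> Y \<Longrightarrow> (c + y) dvd s" "\<And>y. y \<in> Y \<Longrightarrow> 0 < y \<and> y < x"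
  shows "2 * x * (real (card Y) - 1) \<le> s"
proof -
  have "2 * real x * (x + (0::nat)) * (real (card Y) - 1) \<le> real s * (real x - (0::nat))"
    using assms by (intro shifted_divisors_spread) auto
  then have "real x * (2 * x * (real (card Y) - 1)) \<le> real x * s" by (simp add: mult_ac)
  then show ?thesis using assms(4) by simp
qed

text \<open>The bound in \<open>shifted_divisors_spread\<close> rearranges to \<open>w (1 + v) \<le> x (1 - v)\<close> with
  \<open>v = 2 x (card Y - 1) / s\<close>, and \<open>v (1 - v) \<le> 1/4\<close>.\<close>

lemma shifted_divisors_lower:
  fixes Y :: "nat set" and s c x w :: nat
  assumes "finite Y" "Y \<noteq> {}" "0 < s" "0 < x" "x \<le> c"
    and "\<And>y. y \<in> Y \<Longrightarrow> (c + y) dvd s" "\<And>y. y \<in> Y \<Longrightarrow> w < y \<and> y < x"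
  shows "8 * w * (real (card Y) - 1) \<le> s"
proof -
  define N where "N = real (card Y) - 1"
  have "card Y > 0" using assms(1,2) by (simp add: card_gt_0_iff)
  then have N: "N \<ge> 0" by (simp add: N_def)
  have *: "2 * real x * (real x + w) * N \<le> real s * (real x - w)"
    using shifted_divisors_spread[OF assms] by (simp add: N_def)
  define v where "v = 2 * x * N / s"
  have s: "real s > 0" using assms(3) by simp
  have v0: "v \<ge> 0" using N by (simp add: v_def)
  have "(real x + w) * v \<le> real x - w"
    using * s by (simp add: v_def field_simps)
  then have "w * (1 + v) \<le> x * (1 - v)" by (simp add: algebra_simps)
  moreover have "real w * 1 \<le> w * (1 + v)" using v0 by (intro mult_left_mono) auto
  ultimately have "w \<le> x * (1 - v)" by simp
  then have "w * (8 * N) \<le> x * (1 - v) * (8 * N)" using N by (intro mult_right_mono) auto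
  also have "\<dots> = 4 * s * (v * (1 - v))" using s by (simp add: v_def field_simps)
  also have "\<dots> \<le> 4 * s * (1 / 4)"
  proof (intro mult_left_mono)
    have "0 \<le> (v - 1 / 2)\<^sup>2" by simp
    then show "v * (1 - v) \<le> 1 / 4" by (simp add: power2_eq_square algebra_simps)
  qed simp
  finally show ?thesis by (simp add: N_def mult_ac)
qed

section \<open>Sets with many divisors and no dominant element\<close>

lemma binomial_ratio: "Suc j * (m choose Suc j) = (m - j) * (m choose j)"
  using binomial_absorption[of j m] binomial_absorb_comp[of m j] by simp

text \<open>The situation left once a dominant element is excluded: many divisors, and every element
  below half of the total. The lemmas in this context combine to bound \<open>n\<close>.\<close>

locale many_divisors =
  fixes A :: "nat set" and k n s :: nat
  assumes finite_A: "finite A" and card_A: "card A = n" and sum_A: "\<Sum>A = s"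
    and pos: "\<And>x. x \<in> A \<Longrightarrow> 0 < x" and less_half: "\<And>x. x \<in> A \<Longrightarrow> 2 * x < s"
    and k: "1 < k" "k < n"
    and many: "((n - 1) choose k) \<le> card (k_divisors k A)"
begin

lemma k_divisors_eq: "k_divisors k A = {B \<in> nsets A k. \<Sum>B dvd s}"
  by (auto simp: k_divisors_def is_divisor_def nsets_def sum_A)

lemma finite_nsets_A: "finite (nsets A j)"
  using finite_A by (rule finite_imp_finite_nsets)

lemma s_pos: "0 < s"
proof -
  have "A \<noteq> {}" using k card_A by auto
  then show ?thesis using less_half by fastforce
qed

lemma binomial_pos: "0 < (n - 1) choose k"
  using k by simp

lemma sum_less: "B \<in> nsets A k \<Longrightarrow> 0 < \<Sum>B \<and> \<Sum>B < s"
proof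
  assume B: "B \<in> nsets A k"
  then have "B \<noteq> {}" "B \<subseteq> A" "finite B" "card B = k" using k by (auto simp: nsets_def)
  then have "B \<noteq> A" using k card_A by auto
  then obtain x where x: "x \<in> A" "x \<notin> B" using \<open>B \<subseteq> A\<close> by blast
  have "\<Sum>B < \<Sum>A"
    using sum_strict_mono2[OF finite_A \<open>B \<subseteq> A\<close>, of x "\<lambda>x. x"] x pos by auto
  then show "\<Sum>B < s" by (simp add: sum_A)
  show "0 < \<Sum>B" using \<open>B \<noteq> {}\<close> \<open>B \<subseteq> A\<close> \<open>finite B\<close> pos by (intro sum_pos) auto
qed

lemma card_sum_eq: "card {B \<in> nsets A k. \<Sum>B = c} * ((n - k) * (k + 1)) \<le> n * ((n - 1) choose k)"
  using card_nsets_sum_eq_le[OF finite_A, of k c] k by (simp add: card_A)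

text \<open>The hypothesis \<open>many\<close> in the form used for contradictions: any finite
  family covering the divisors is at least this large.\<close>

lemma card_k_divisors_le:
  assumes "k_divisors k A \<subseteq> X" "finite X"
  shows "((n - 1) choose k) \<le> card X"
  using many card_mono[OF assms(2,1)] by simp

lemma card_nsets_avoiding_pair:
  assumes "x \<in> A" "y \<in> A" "x \<noteq> y"
  shows "card (nsets (A - {x, y}) k) = (n - 2) choose k"
  using card_nsets_diff[OF finite_A, of "{x, y}" k] assms by (simp add: card_A numeral_2_eq_2)

section \<open>The regime n <= 20000 k: bounding n - k\<close>

text \<open>A divisor has sum at most s / 160000, or sum s / m with m < 160000. The first kind
  misses at least N / 80000 of the required N sets. The fewer than 160000 values of m must supply
  these, with at most 20000 N / l sets each, so l <= 80000 * 160000 * 20000.\<close>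

lemma codegree_bounded:
  assumes "n \<le> 20000 * k"
  shows "n - k \<le> 256000000000000"
proof -
  define N l where "N = real ((n - 1) choose k)" and "l = n - k"
  have N: "N > 0" using binomial_pos by (simp add: N_def)
  have l: "l > 0" using k by (simp add: l_def)
  define M :: nat where "M = 160000"
  let ?S = "{B \<in> nsets A k. real (\<Sum>B) \<le> (1 / 160000) * real (\<Sum>A)}"
  let ?E = "\<lambda>m. {B \<in> nsets A k. \<Sum>B = s div m}"
  have "k_divisors k A \<subseteq> ?S \<union> (\<Union>m\<in>{1..<M}. ?E m)"
  proof
    fix B assume "B \<in> k_divisors k A"
    then have B: "B \<in> nsets A k" "\<Sum>B dvd s" by (auto simp: k_divisors_eq)
    then obtain m where m: "s = \<Sum>B * m" by blast
    then have m0: "m \<noteq> 0" using s_pos by (intro notI) simp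
    show "B \<in> ?S \<union> (\<Union>m\<in>{1..<M}. ?E m)"
    proof (cases "m < M")
      case True
      have "s div m = \<Sum>B" using m m0 by simp
      then have "B \<in> ?E m" using B by simp
      moreover have "m \<in> {1..<M}" using True m0 by simp
      ultimately show ?thesis by blast
    next
      case False
      then have "\<Sum>B * 160000 \<le> s" unfolding m by (intro mult_left_mono) (auto simp: M_def)
      then have "real (\<Sum>B) * 160000 \<le> real s" by (metis of_nat_le_iff of_nat_mult of_nat_numeral)
      then show ?thesis using B by (simp add: sum_A del: of_nat_sum)
    qed
  qed
  then have "((n - 1) choose k) \<le> card (?S \<union> (\<Union>m\<in>{1..<M}. ?E m))"
    by (rule card_k_divisors_le) (use finite_nsets_A in auto)
  also have "\<dots> \<le> card ?S + (\<Sum>m\<in>{1..<M}. card (?E m))"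
    by (rule order_trans[OF card_Un_le add_left_mono]) (rule card_UN_le, simp)
  finally have 1: "N \<le> real (card ?S) + (\<Sum>m\<in>{1..<M}. real (card (?E m)))"
    unfolding N_def of_nat_sum[symmetric] of_nat_add[symmetric] by (rule of_nat_mono)
  have "real (card (?E m)) \<le> N * 20000 / l" for m
  proof -
    have "real (card (?E m) * (l * (k + 1))) \<le> real (n * ((n - 1) choose k))"
      using card_sum_eq[of "s div m"] unfolding l_def by (rule of_nat_mono)
    then have "real (card (?E m)) * l * (real k + 1) \<le> n * N" by (simp add: N_def algebra_simps)
    also have "\<dots> \<le> (20000 * (real k + 1)) * N" using assms N by (intro mult_right_mono) auto
    finally have "(real (card (?E m)) * l) * (real k + 1) \<le> (20000 * N) * (real k + 1)" by (simp add: mult_ac)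
    then have "real (card (?E m)) * l \<le> 20000 * N" by (rule mult_right_le_imp_le) simp
    then show ?thesis using l by (simp add: field_simps)
  qed
  then have "(\<Sum>m\<in>{1..<M}. real (card (?E m))) \<le> (\<Sum>m\<in>{1..<M}. N * 20000 / l)" by (intro sum_mono)
  also have "\<dots> = real (M - 1) * (N * 20000 / l)" by simp
  also have "\<dots> \<le> 160000 * (N * 20000 / l)" using N by (intro mult_right_mono) (auto simp: M_def)
  finally have 2: "(\<Sum>m\<in>{1..<M}. real (card (?E m))) \<le> 160000 * (N * 20000 / l)" .
  have "real (card ?S) * (1 - 1 / 160000)\<^sup>2 \<le> N * (1 - k / (2 * (real n - 1)))"
    using card_nsets_small_sum_le[OF finite_A, of k "1 / 160000"] k less_half s_pos
    by (simp add: card_A sum_A N_def less_imp_le del: of_nat_sum)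
  \<comment> \<open>From n <= 20000 k the saving k / (2 (n - 1)) is at least 1 / 40000. The
    threshold 1 / 160000 is small enough that its square loss costs only one factor 1 - 1 / 80000 of
    the two gained here.\<close>
  also have "\<dots> \<le> N * (1 - 1 / 80000)\<^sup>2"
  proof (intro mult_left_mono)
    have "1 / 40000 \<le> k / (2 * (real n - 1))" using assms k by (simp add: field_simps)
    then have "1 - k / (2 * (real n - 1)) \<le> 39999 / 40000" by linarith
    also have "\<dots> \<le> (1 - 1 / 80000)\<^sup>2" by (simp add: power2_eq_square)
    finally show "1 - k / (2 * (real n - 1)) \<le> (1 - 1 / 80000)\<^sup>2" .
  qed (use N in auto)
  finally have "real (card ?S) * (1 - 1 / 160000)\<^sup>2 \<le> N * (1 - 1 / 80000)\<^sup>2" .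
  moreover have "real (card ?S) * (1 - 1 / 80000) \<le> real (card ?S) * (1 - 1 / 160000)\<^sup>2"
    by (intro mult_left_mono) (auto simp: power2_eq_square)
  ultimately have "real (card ?S) * (1 - 1 / 80000) \<le> (N * (1 - 1 / 80000)) * (1 - 1 / 80000)"
    by (simp add: power2_eq_square mult.assoc)
  then have 3: "real (card ?S) \<le> N * (1 - 1 / 80000)" by (rule mult_right_le_imp_le) simp
  have "N * (1 / 80000) \<le> q" if "N \<le> a + b" "b \<le> q" "a \<le> N * (1 - 1 / 80000)" for a b q
    using that by (simp add: algebra_simps)
  from this[OF 1 2 3] have "N * (1 / 80000) \<le> 160000 * (N * 20000 / l)" .
  then have "N * (1 / 80000) \<le> N * (3200000000 / l)" by simp
  then have "1 / 80000 \<le> 3200000000 / real l" using N by (rule mult_left_le_imp_le)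
  then have "real l \<le> 256000000000000" using l by (simp add: field_simps)
  then show ?thesis by (simp add: l_def)
qed

section \<open>Bounding n in terms of l = n - k\<close>

text \<open>If n exceeded the bound, fewer than N / 3 sets would omit two elements of
  \<open>H\<close>, and at most 2 N / 3 would have sum s / 2. These two families cover all divisors,
  which contradicts the required count N.\<close>

lemma bounded_by_codegree:
  defines "l \<equiv> n - k"
  shows "n \<le> 108 * l ^ 3 + 4 * l + 1"
proof (rule ccontr)
  assume "\<not> ?thesis"
  then have n: "108 * l ^ 3 + 4 * l + 1 < n" by simp
  define N where "N = (n - 1) choose k"
  have N: "N > 0" using binomial_pos by (simp add: N_def)
  have l: "l > 0" using k by (simp add: l_def)
  define H where "H = {x \<in> A. s < 6 * l * x}"
  have "finite H" "H \<subseteq> A" using finite_A by (auto simp: H_def)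
  have "card H * s \<le> (\<Sum>x\<in>H. 6 * l * x)"
    using sum_mono[of H "\<lambda>_. s" "\<lambda>x. 6 * l * x"] by (simp add: H_def less_imp_le)
  also have "\<dots> \<le> 6 * l * s"
    using \<open>H \<subseteq> A\<close> finite_A sum_mono2[OF finite_A \<open>H \<subseteq> A\<close>, of "\<lambda>x. x"]
    by (simp add: sum_distrib_left[symmetric] sum_A)
  finally have cH: "card H \<le> 6 * l" using s_pos by simp
  \<comment> \<open>The condition 2 <= l makes \<open>?E\<close> empty for l = 1, where the bound on
    sets of equal sum would be too weak.\<close>
  let ?E = "{B \<in> nsets A k. 2 \<le> l \<and> \<Sum>B = s div 2}"
  let ?P = "\<Union>x\<in>H. \<Union>y\<in>H - {x}. nsets (A - {x, y}) k"
  have "k_divisors k A \<subseteq> ?E \<union> ?P"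
  proof
    fix B assume "B \<in> k_divisors k A"
    then have B: "B \<in> nsets A k" "\<Sum>B dvd s" by (auto simp: k_divisors_eq)
    then have BA: "B \<subseteq> A" "finite B" "card B = k" by (auto simp: nsets_def)
    have cl: "card (A - B) = l" using BA by (simp add: card_Diff_subset card_A l_def)
    show "B \<in> ?E \<union> ?P"
    proof (cases "B \<in> ?P")
      case False
      then have sub: "x = y" if "x \<in> H - B" "y \<in> H - B" for x y
        using that B(1) by (auto simp: nsets_diff)
      \<comment> \<open>\<open>h\<close> is the only heavy element outside \<open>B\<close>; if
        there is none, any element outside \<open>B\<close> serves.\<close>
      have "\<exists>h\<in>A - B. H - B \<subseteq> {h}"
      proof (cases "H - B = {}")
        case True
        moreover have "A - B \<noteq> {}" using cl l by (metis card.empty less_irrefl)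
        ultimately show ?thesis by auto
      next
        case False
        then show ?thesis using sub \<open>H \<subseteq> A\<close> by blast
      qed
      then obtain h where h: "h \<in> A - B" "H - B \<subseteq> {h}" by blast
      have "6 * l * \<Sum>(A - B - {h}) \<le> (\<Sum>x\<in>A - B - {h}. s)"
        unfolding sum_distrib_left using h by (intro sum_mono) (auto simp: H_def not_less)
      also have "\<dots> = (l - 1) * s" using h cl finite_A by (simp add: card_Diff_subset)
      also have "\<dots> \<le> l * s" by simp
      finally have "6 * l * \<Sum>(A - B - {h}) \<le> l * s" .
      moreover have e: "\<Sum>(A - B) = h + \<Sum>(A - B - {h})"
        using h finite_A by (intro sum.remove) auto
      moreover have "6 * l * h < 3 * l * s" using less_half[of h] h l by simp
      \<comment> \<open>The element \<open>h\<close> weighs less than s / 2 and the other l - 1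
        together at most s / 6. Hence the complement weighs less than 2 s / 3, \<open>B\<close> more
        than s / 3, and the quotient of a proper divisor can only be 2.\<close>
      ultimately have "6 * l * \<Sum>(A - B) < 4 * l * s"
        unfolding e distrib_left by linarith
      then have "l * (6 * \<Sum>(A - B)) < l * (4 * s)" by (simp add: mult_ac)
      then have small: "3 * \<Sum>(A - B) < 2 * s" by simp
      have sB: "\<Sum>(A - B) + \<Sum>B = s" using finite_A BA(1) by (metis sum_A sum.subset_diff)
      obtain m where m: "s = \<Sum>B * m" using B by blast
      have "\<Sum>B < s" "0 < \<Sum>B" using sum_less B by auto
      have "m < 3"
      proof (rule ccontr)
        assume "\<not> m < 3"
        then have "\<Sum>B * 3 \<le> \<Sum>B * m" by (intro mult_left_mono) auto
        then show False using small sB m by linarith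
      qed
      moreover have "m \<noteq> 0" "m \<noteq> 1" using m \<open>\<Sum>B < s\<close> s_pos by (auto simp del: sum_eq_0_iff)
      ultimately have "m = 2" by linarith
      then have half: "\<Sum>B = s div 2" using m by simp
      \<comment> \<open>For l = 1 the complement is the single element \<open>h\<close>, which would
        weigh exactly s / 2.\<close>
      moreover have "2 \<le> l"
      proof (rule ccontr)
        assume "\<not> 2 \<le> l"
        then have "card (A - B - {h}) = 0" using cl l h by (simp add: card_Diff_subset)
        then have "A - B - {h} = {}" using finite_A by (simp only: card_0_eq finite_Diff)
        then have "\<Sum>(A - B) = h" using e by (simp only: sum.empty add_0_right)
        then show False using less_half[of h] h sB m \<open>m = 2\<close> by auto
      qed
      ultimately show ?thesis using B by simp
    qed simp
  qed
  moreover have "finite (?E \<union> ?P)"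
    using finite_nsets_A \<open>finite H\<close> finite_A by (auto intro: finite_imp_finite_nsets)
  ultimately have "N \<le> card (?E \<union> ?P)" unfolding N_def by (rule card_k_divisors_le)
  also have "\<dots> \<le> card ?E + card ?P" by (rule card_Un_le)
  finally have 1: "N \<le> card ?E + card ?P" .
  have "card ?P \<le> (\<Sum>x\<in>H. \<Sum>y\<in>H - {x}. card (nsets (A - {x, y}) k))"
    using \<open>finite H\<close> by (intro order_trans[OF card_UN_le] sum_mono card_UN_le) auto
  also have "\<dots> = (\<Sum>x\<in>H. \<Sum>y\<in>H - {x}. (n - 2) choose k)"
    using \<open>H \<subseteq> A\<close> by (intro sum.cong refl card_nsets_avoiding_pair) auto
  also have "\<dots> \<le> (\<Sum>x\<in>H. \<Sum>y\<in>H. (n - 2) choose k)"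
    using \<open>finite H\<close> by (intro sum_mono sum_mono2) auto
  also have "\<dots> = (card H)\<^sup>2 * ((n - 2) choose k)" by (simp add: power2_eq_square)
  also have "\<dots> \<le> (6 * l)\<^sup>2 * ((n - 2) choose k)" using cH by (intro mult_right_mono power_mono) auto
  finally have "card ?P * (n - 1) \<le> (6 * l)\<^sup>2 * ((n - 2) choose k) * (n - 1)" by (rule mult_right_mono) simp
  also have "(6 * l)\<^sup>2 * ((n - 2) choose k) * (n - 1) = (6 * l)\<^sup>2 * ((l - 1) * N)"
    using binomial_absorb_comp[of "n - 1" k] k
    by (simp add: N_def l_def numeral_2_eq_2 mult.assoc mult.commute[of _ "n - Suc 0"] add.commute)
  also have "\<dots> \<le> (6 * l)\<^sup>2 * (l * N)" by (intro mult_left_mono mult_right_mono) auto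
  also have "\<dots> = 36 * l ^ 3 * N" by (simp add: power2_eq_square power3_eq_cube)
  finally have "card ?P * (n - 1) \<le> 36 * l ^ 3 * N" .
  \<comment> \<open>The cubic term of the assumed bound is three times 36 l^3, so that
    \<open>?P\<close> stays below N / 3.\<close>
  then have "3 * card ?P * (n - 1) \<le> 108 * l ^ 3 * N" by (simp add: mult_ac)
  also have "\<dots> < (n - 1) * N" using n N by (intro mult_strict_right_mono) auto
  finally have P: "3 * card ?P < N" by (simp add: mult.commute)
  have "card ?E * 3 \<le> 2 * N"
  proof (cases "2 \<le> l")
    case True
    \<comment> \<open>The linear term of the bound gives n / (k + 1) <= 4 / 3; with l >= 2 a single
      sum is attained by at most 2 N / 3 sets.\<close>
    have "3 * n \<le> 4 * (k + 1)" using n by (simp add: l_def)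
    then have "2 * (3 * n) \<le> l * (4 * (k + 1))" using mult_mono[OF True, of "3 * n" "4 * (k + 1)"] by simp
    then have "card ?E * (2 * (3 * n)) \<le> card ?E * (l * (4 * (k + 1)))" by (rule mult_left_mono) simp
    also have "\<dots> = 4 * (card ?E * (l * (k + 1)))" by (simp only: mult_ac)
    also have "card ?E * (l * (k + 1)) \<le> n * N"
      using card_sum_eq[of "s div 2"] True by (simp only: l_def N_def simp_thms)
    finally have "n * (card ?E * 6) \<le> n * (4 * N)" by simp
    then show ?thesis using k by simp
  qed simp
  then show False using 1 P by simp
qed

section \<open>The regime 20000 k < n: bounding n\<close>

lemma binomial_step: "(k - 1) * ((n - 1) choose (k - 1)) = (n - k + 1) * ((n - 1) choose (k - 2))"
proof -
  have "Suc (k - 2) = k - 1" "n - 1 - (k - 2) = n - k + 1" using k by auto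
  then show ?thesis using binomial_ratio[of "k - 2" "n - 1"] by simp
qed

text \<open>A (k - 1)-set containing \<open>x\<close> has sum at least \<open>x\<close>, so fewer
  than n / 8 elements extend it to a divisor. Double counting then leaves at most a quarter of the
  \<open>k\<close>-sets through \<open>x\<close> as divisors, since n <= 2 (n - k + 1).\<close>

lemma card_good_containing:
  assumes "x \<in> A" "8 * s < n * x" "2 * k \<le> n"
  shows "4 * card {B \<in> nsets A k. x \<in> B \<and> \<Sum>B dvd s} \<le> (n - 1) choose (k - 1)"
proof -
  let ?G = "card {B \<in> nsets A k. x \<in> B \<and> \<Sum>B dvd s}" and ?F = "{D \<in> nsets A (k - 1). x \<in> D}"
  have ext: "8 * card {y \<in> A - D. \<Sum>(insert y D) dvd s} \<le> n" if D: "D \<in> ?F" for D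
  proof -
    let ?Y = "{y \<in> A - D. \<Sum>(insert y D) dvd s}"
    have fD: "finite D" "D \<subseteq> A" "x \<in> D" using D by (auto simp: nsets_def)
    have xD: "x \<le> \<Sum>D" using fD by (intro member_le_sum) auto
    have "card ?Y * \<Sum>D \<le> s"
    proof (rule shifted_divisors_count)
      show "\<Sum>D + y dvd s" if "y \<in> ?Y" for y
      proof -
        have "y \<notin> D" "\<Sum>(insert y D) dvd s" using that by auto
        then show ?thesis using fD by (simp add: add.commute)
      qed
      show "0 < \<Sum>D" using xD pos[OF assms(1)] by linarith
    qed (use finite_A s_pos in auto)
    then have "card ?Y * x \<le> s" using xD by (meson mult_le_mono2 order_trans)
    then have "8 * card ?Y * x < n * x" using assms(2) by linarith
    then show ?thesis by simp
  qed
  have "8 * ((k - 1) * ?G) = (\<Sum>D\<in>?F. 8 * card {y \<in> A - D. \<Sum>(insert y D) dvd s})"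
    using double_count_extensions[OF finite_A assms(1), of k "\<lambda>B. \<Sum>B dvd s"] k
    by (simp add: sum_distrib_left[symmetric])
  also have "\<dots> \<le> (\<Sum>D\<in>?F. n)" by (intro sum_mono ext)
  also have "\<dots> = n * ((n - 1) choose (k - 2))"
    using card_nsets_containing[OF finite_A assms(1), of "k - 1"] k by (simp add: card_A numeral_2_eq_2)
  also have "\<dots> \<le> (2 * (n - k + 1)) * ((n - 1) choose (k - 2))"
    using assms(3) by (intro mult_right_mono) auto
  also have "\<dots> = 2 * ((k - 1) * ((n - 1) choose (k - 1)))" unfolding binomial_step by simp
  finally have "(k - 1) * (4 * ?G) \<le> (k - 1) * ((n - 1) choose (k - 1))" by simp
  then show ?thesis using k by simp
qed

text \<open>With two heavy elements, at most K / 2 divisors meet the pair, while (n - 2) choose k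
  sets avoid it. By Pascal's rule (n - 2) choose (k - 1) is then at most K / 2; but it equals K (n -
  k) / (n - 1), which exceeds K / 2 when 2 k <= n.\<close>

lemma at_most_one_heavy:
  assumes "x \<in> A" "y \<in> A" "x \<noteq> y" "8 * s < n * x" "2 * k \<le> n"
  shows "n * y \<le> 8 * s"
proof (rule ccontr)
  assume "\<not> ?thesis"
  then have y: "8 * s < n * y" by simp
  let ?G = "\<lambda>x. {B \<in> nsets A k. x \<in> B \<and> \<Sum>B dvd s}"
  define K where "K = (n - 1) choose (k - 1)"
  have "k_divisors k A \<subseteq> (?G x \<union> ?G y) \<union> nsets (A - {x, y}) k"
    by (auto simp: k_divisors_eq nsets_diff)
  then have "((n - 1) choose k) \<le> card ((?G x \<union> ?G y) \<union> nsets (A - {x, y}) k)"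
    by (rule card_k_divisors_le) (use finite_nsets_A finite_A in \<open>auto intro: finite_imp_finite_nsets\<close>)
  also have "\<dots> \<le> (card (?G x) + card (?G y)) + card (nsets (A - {x, y}) k)"
    by (intro order_trans[OF card_Un_le] add_mono card_Un_le order_refl)
  also have "card (nsets (A - {x, y}) k) = (n - 2) choose k"
    using assms by (intro card_nsets_avoiding_pair) auto
  finally have "(n - 1) choose k \<le> card (?G x) + card (?G y) + ((n - 2) choose k)" .
  moreover have "(n - 1) choose k = ((n - 2) choose (k - 1)) + ((n - 2) choose k)"
    using choose_reduce_nat[of "n - 1" k] k by (simp add: numeral_2_eq_2)
  moreover have "4 * card (?G x) \<le> K" "4 * card (?G y) \<le> K"
    using card_good_containing assms y by (auto simp: K_def)
  ultimately have 1: "2 * ((n - 2) choose (k - 1)) \<le> K" by linarith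
  have "(n - k) * K = (n - 1) * ((n - 2) choose (k - 1))"
    using binomial_absorb_comp[of "n - 1" "k - 1"] k by (simp add: K_def numeral_2_eq_2)
  then have "2 * (n - k) * K = (n - 1) * (2 * ((n - 2) choose (k - 1)))" by simp
  also have "\<dots> \<le> (n - 1) * K" using 1 by (intro mult_left_mono) auto
  finally have "2 * (n - k) \<le> n - 1" using k by (simp add: K_def)
  then show False using assms(5) k by linarith
qed

text \<open>There are at most K = (n - 1) choose (k - 1) non-divisors, and each contains at most
  \<open>k\<close> elements of \<open>U\<close>. If every D through every x in \<open>U\<close> had
  \<open>t\<close> bad extensions, double counting would give |U| t P <= k (k - 1) K = k (n - k + 1)
  P, against the hypothesis.\<close>

lemma exists_extendable:
  assumes "U \<subseteq> A" "k * n < card U * t"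
  shows "\<exists>x\<in>U. \<exists>D\<in>nsets A (k - 1). x \<in> D \<and> card {y \<in> A - D. \<not> \<Sum>(insert y D) dvd s} < t"
proof (rule ccontr)
  assume contra: "\<not> ?thesis"
  define K P where "K = (n - 1) choose (k - 1)" and "P = (n - 1) choose (k - 2)"
  let ?bad = "\<lambda>B. \<not> \<Sum>B dvd s"
  let ?B = "{B \<in> nsets A k. ?bad B}"
  have fU: "finite U" using assms(1) finite_A finite_subset by blast
  have fB: "finite ?B" using finite_nsets_A by simp
  have "P * t \<le> (k - 1) * card {B \<in> nsets A k. x \<in> B \<and> ?bad B}" if x: "x \<in> U" for x
  proof -
    let ?F = "{D \<in> nsets A (k - 1). x \<in> D}"
    have "x \<in> A" using x assms(1) by auto
    then have "P * t = (\<Sum>D\<in>?F. t)"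
      using card_nsets_containing[OF finite_A, of x "k - 1"] k by (simp add: card_A P_def numeral_2_eq_2)
    also have "\<dots> \<le> (\<Sum>D\<in>?F. card {y \<in> A - D. ?bad (insert y D)})"
      using contra x by (intro sum_mono) (auto simp: not_less)
    also have "\<dots> = (k - 1) * card {B \<in> nsets A k. x \<in> B \<and> ?bad B}"
      using k by (intro double_count_extensions[OF finite_A \<open>x \<in> A\<close>]) auto
    finally show ?thesis .
  qed
  then have "card U * (P * t) \<le> (\<Sum>x\<in>U. (k - 1) * card {B \<in> nsets A k. x \<in> B \<and> ?bad B})"
    by (metis (no_types, lifting) sum_bounded_below of_nat_id)
  also have "\<dots> = (k - 1) * (\<Sum>x\<in>U. card {B \<in> ?B. x \<in> B})"
    by (simp add: sum_distrib_left conj_commute conj_left_commute)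
  also have "(\<Sum>x\<in>U. card {B \<in> ?B. x \<in> B}) = (\<Sum>B\<in>?B. card {x \<in> U. x \<in> B})"
    using fU fB by (rule sum_multicount_gen) simp
  also have "\<dots> \<le> (\<Sum>B\<in>?B. k)"
  proof (rule sum_mono)
    fix B assume "B \<in> ?B"
    then have "finite B" "card B = k" by (auto simp: nsets_def)
    then show "card {x \<in> U. x \<in> B} \<le> k" using card_mono[of B "{x \<in> U. x \<in> B}"] by auto
  qed
  also have "\<dots> \<le> k * K"
  proof -
    have "?B = nsets A k - k_divisors k A" by (auto simp: k_divisors_eq)
    moreover have "k_divisors k A \<subseteq> nsets A k" by (auto simp: k_divisors_eq)
    ultimately have "card ?B = (n choose k) - card (k_divisors k A)"
      using finite_nsets_A by (simp add: card_Diff_subset finite_subset card_A)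
    moreover have "n choose k = K + ((n - 1) choose k)"
      unfolding K_def using k by (intro choose_reduce_nat) auto
    ultimately have "card ?B \<le> K" using many by linarith
    then show ?thesis by simp
  qed
  finally have "card U * (P * t) \<le> k * ((k - 1) * K)" by (simp add: mult.left_commute)
  also have "\<dots> = k * (n - k + 1) * P" unfolding K_def P_def binomial_step by (simp only: mult.assoc)
  also have "\<dots> \<le> k * n * P" using k by (intro mult_right_mono mult_left_mono) auto
  finally have "card U * t * P \<le> k * n * P" by (simp add: mult_ac)
  moreover have "P > 0" using k by (simp add: P_def)
  ultimately show False using assms(2) by simp
qed

text \<open>\<open>A\<close> is cut into a top layer \<open>U\<close> of about n / 100 elements, a
  layer \<open>V\<close> of about n / 2, and the rest \<open>W\<close>. One \<open>D\<close> with
  many extensions bounds the elements of \<open>V\<close> and of \<open>W\<close>, and the shares of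
  all layers add up to less than \<open>s\<close>.\<close>

lemma bounded_of_small_k:
  assumes "20000 * k < n"
  shows "n < 100000"
proof (rule ccontr)
  assume "\<not> ?thesis"
  then have n: "100000 \<le> n" by simp
  define u where "u = n div 100"
  define h where "h = n div 2"
  have u: "n \<le> 101 * u" "100 * u \<le> n" "0 < u" using n by (auto simp: u_def)
  have h: "n \<le> 2 * h + 1" "2 * h \<le> n" by (auto simp: h_def)
  obtain U where U: "U \<subseteq> A" "card U = u" "\<forall>x\<in>U. \<forall>y\<in>A - U. y < x"
    using exists_top_subset[OF finite_A, of u] u by (auto simp: card_A)
  have finU: "finite U" using U(1) finite_A finite_subset by blast
  have cAU: "card (A - U) = n - u" using U(1,2) finU by (simp add: card_Diff_subset card_A)
  obtain V where V: "V \<subseteq> A - U" "card V = h" "\<forall>x\<in>V. \<forall>y\<in>A - U - V. y < x"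
  proof -
    have "h \<le> card (A - U)" using cAU u h by linarith
    then show ?thesis using exists_top_subset[of "A - U" h] finite_A that by blast
  qed
  have finV: "finite V" using V(1) finite_A finite_subset by blast
  define W where "W = A - U - V"
  have cW: "card W = n - u - h" using V(1,2) finV cAU by (simp add: W_def card_Diff_subset)
  \<comment> \<open>Here 20000 enters: n <= 101 u and 101^2 = 10201 < 20000.\<close>
  have "k * n < u * u"
  proof -
    have "n * n \<le> 10201 * (u * u)" using mult_mono[OF u(1) u(1)] by simp
    moreover have "20000 * (k * n) < n * n" using mult_strict_right_mono[OF assms, of n] n by simp
    ultimately show ?thesis by linarith
  qed
  then obtain x D where x: "x \<in> U" and D: "D \<in> nsets A (k - 1)" "x \<in> D"
    and bad: "card {y \<in> A - D. \<not> \<Sum>(insert y D) dvd s} < u"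
    using exists_extendable[of U u] U(1,2) by auto
  have fD: "finite D" "D \<subseteq> A" "card D = k - 1" using D by (auto simp: nsets_def)
  have xA: "x \<in> A" using x U(1) by auto
  have xD: "x \<le> \<Sum>D" using fD D by (intro member_le_sum) auto
  \<comment> \<open>The members of \<open>S\<close> that extend \<open>D\<close> to a divisor. At
    most k + u members are lost: those in \<open>D\<close> and the bad ones.\<close>
  define ext where "ext S = {y \<in> S - D. \<Sum>(insert y D) dvd s}" for S
  have ext_card: "card S \<le> card (ext S) + k + u" if "S \<subseteq> A" for S
  proof -
    have "S \<subseteq> ext S \<union> (D \<union> {y \<in> A - D. \<not> \<Sum>(insert y D) dvd s})" using that by (auto simp: ext_def)
    moreover have "finite (ext S \<union> (D \<union> {y \<in> A - D. \<not> \<Sum>(insert y D) dvd s}))"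
      using that finite_A fD finite_subset[of S A] by (auto simp: ext_def)
    ultimately have "card S \<le> card (ext S \<union> (D \<union> {y \<in> A - D. \<not> \<Sum>(insert y D) dvd s}))"
      by (rule card_mono[rotated])
    also have "\<dots> \<le> card (ext S) + (card D + card {y \<in> A - D. \<not> \<Sum>(insert y D) dvd s})"
      by (intro order_trans[OF card_Un_le] add_left_mono card_Un_le)
    finally show ?thesis using bad fD by linarith
  qed
  have ext_dvd: "\<Sum>D + y dvd s" if "y \<in> ext S" for S y
  proof -
    have "y \<notin> D" "\<Sum>(insert y D) dvd s" using that by (auto simp: ext_def)
    then show ?thesis using fD by (simp add: add.commute)
  qed
  have fin_ext: "finite (ext S)" if "S \<subseteq> A" for S
    using that finite_A finite_subset[of S A] by (auto simp: ext_def)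

  have "n - u \<le> card (ext (A - U)) + k + u" using ext_card[of "A - U"] cAU by auto
  \<comment> \<open>The loss is 2 u + k, little more than 2 n / 100; the spare 100 absorbs the - 1
    in card - 1.\<close>
  then have e1: "97 * n + 100 \<le> 100 * card (ext (A - U))" using u assms n by linarith
  then have ne: "ext (A - U) \<noteq> {}" by auto
  have "2 * x * (real (card (ext (A - U))) - 1) \<le> s"
  proof (rule shifted_divisors_upper[OF fin_ext[OF Diff_subset] ne s_pos pos[OF xA] xD ext_dvd])
    fix y assume "y \<in> ext (A - U)"
    then have "y \<in> A - U" by (auto simp: ext_def)
    then show "0 < y \<and> y < x" using U(3) x pos by blast
  qed
  moreover have "97 * real n \<le> 100 * (real (card (ext (A - U))) - 1)"
    using of_nat_mono[OF e1, where 'a = real] by simp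
  ultimately have xle: "194 * (real n * x) \<le> 100 * s"
    using mult_left_mono[of "97 * real n" "100 * (real (card (ext (A - U))) - 1)" "2 * real x"]
    by (simp add: algebra_simps)
  have Vle: "194 * n * y \<le> 100 * s" if "y \<in> V" for y
  proof -
    have "y \<in> A - U" using V(1) that by blast
    then have "y \<le> x" using U(3) x less_imp_le by blast
    then have "194 * (real n * y) \<le> 194 * (real n * x)" by (intro mult_left_mono) auto
    then have "real (194 * n * y) \<le> real (100 * s)" using xle by simp
    then show ?thesis by (simp only: of_nat_le_iff)
  qed

  have VA: "V \<subseteq> A" using V(1) by auto
  have "h \<le> card (ext V) + k + u" using ext_card[OF VA] V(2) by simp
  then have e2: "48 * n + 100 \<le> 100 * card (ext V)" using u h assms n by linarith
  then have ne: "ext V \<noteq> {}" using n by auto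
  \<comment> \<open>Every \<open>w\<close> in \<open>W\<close> lies below all of \<open>V\<close>,
    whose at least 0.48 n extending elements lie between \<open>w\<close> and \<open>x\<close>; 384
    is 8 * 48.\<close>
  have Wle: "384 * n * w \<le> 100 * s" if w: "w \<in> W" for w
  proof -
    have "8 * w * (real (card (ext V)) - 1) \<le> s"
    proof (rule shifted_divisors_lower[OF fin_ext[OF VA] ne s_pos pos[OF xA] xD ext_dvd])
      fix y assume "y \<in> ext V"
      then have "y \<in> V" by (auto simp: ext_def)
      then have "y \<in> A - U" using V(1) by blast
      then have "y < x" using U(3) x by blast
      moreover have "w < y" using V(3) \<open>y \<in> V\<close> w unfolding W_def by blast
      ultimately show "w < y \<and> y < x" by blast
    qed
    moreover have "48 * real n \<le> 100 * (real (card (ext V)) - 1)"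
      using of_nat_mono[OF e2, where 'a = real] by simp
    ultimately have "384 * (real n * w) \<le> 100 * s"
      using mult_left_mono[of "48 * real n" "100 * (real (card (ext V)) - 1)" "8 * real w"]
      by (simp add: algebra_simps)
    then have "real (384 * n * w) \<le> real (100 * s)" by simp
    then show ?thesis by (simp only: of_nat_le_iff)
  qed

  \<comment> \<open>\<open>z\<close> is the one element that may exceed 8 s / n; if none does,
    \<open>x\<close> is a default choice.\<close>
  obtain z where z: "z \<in> U" "\<forall>y\<in>U - {z}. n * y \<le> 8 * s"
  proof (cases "\<exists>z\<in>U. 8 * s < n * z")
    case True
    then obtain z where "z \<in> U" "8 * s < n * z" by blast
    have "n * y \<le> 8 * s" if "y \<in> U - {z}" for y
      using at_most_one_heavy[of z y] that \<open>z \<in> U\<close> \<open>8 * s < n * z\<close> U(1) assms by auto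
    then show ?thesis using that \<open>z \<in> U\<close> by blast
  next
    case False
    then show ?thesis using x that[of x] by (auto simp: not_less)
  qed

  \<comment> \<open>The shares of s are below 1/2 for \<open>z\<close>, and at most 8/100 for the
    rest of \<open>U\<close>, 100/388 for \<open>V\<close> and 100/768 for \<open>W\<close>: about
    0.97 in total.\<close>
  have "s = \<Sum>U + (\<Sum>V + \<Sum>W)"
    using sum.subset_diff[OF U(1) finite_A, of "\<lambda>x. x"] sum.subset_diff[OF V(1), of "\<lambda>x. x"] finite_A
    by (simp add: W_def sum_A)
  moreover have "\<Sum>U = z + \<Sum>(U - {z})" using z finU by (intro sum.remove) auto
  ultimately have "n * s = n * z + n * \<Sum>(U - {z}) + n * \<Sum>V + n * \<Sum>W"
    by (simp add: distrib_left)
  moreover have "2 * (n * z) < n * s"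
    using less_half[of z] z(1) U(1) n by auto
  moreover have "100 * (n * \<Sum>(U - {z})) \<le> 8 * (n * s)"
  proof -
    have "n * \<Sum>(U - {z}) \<le> (\<Sum>y\<in>U - {z}. 8 * s)"
      unfolding sum_distrib_left using z by (intro sum_mono) auto
    also have "\<dots> = (u - 1) * (8 * s)" using z(1) U(2) finU by simp
    also have "\<dots> \<le> u * (8 * s)" by (intro mult_right_mono) auto
    finally have "100 * (n * \<Sum>(U - {z})) \<le> (100 * u) * (8 * s)" by (simp add: mult_ac)
    also have "\<dots> \<le> n * (8 * s)" using u by (intro mult_right_mono) auto
    finally show ?thesis by simp
  qed
  moreover have "388 * (n * \<Sum>V) \<le> 100 * (n * s)"
  proof -
    have "194 * n * \<Sum>V \<le> (\<Sum>y\<in>V. 100 * s)"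
      unfolding sum_distrib_left by (intro sum_mono Vle)
    also have "\<dots> = h * (100 * s)" using V(2) by simp
    finally have "2 * (194 * n * \<Sum>V) \<le> (2 * h) * (100 * s)" by simp
    also have "\<dots> \<le> n * (100 * s)" using h by (intro mult_right_mono) auto
    finally show ?thesis by simp
  qed
  moreover have "768 * (n * \<Sum>W) \<le> 100 * (n * s)"
  proof -
    have "384 * n * \<Sum>W \<le> (\<Sum>y\<in>W. 100 * s)"
      unfolding sum_distrib_left by (intro sum_mono Wle)
    also have "\<dots> = (n - u - h) * (100 * s)" by (simp add: cW)
    finally have "2 * (384 * n * \<Sum>W) \<le> (2 * (n - u - h)) * (100 * s)" by simp
    also have "\<dots> \<le> n * (100 * s)" using h u by (intro mult_right_mono) auto
    finally show ?thesis by simp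
  qed
  ultimately show False by linarith
qed

end

section \<open>A dominant element, and the conclusion\<close>

text \<open>A proper divisor has sum at most half of the total. A \<open>k\<close>-set with k > 1
  containing the maximum exceeds that, so all divisors avoid the maximum, and the count forces every
  such \<open>k\<close>-set to be one.\<close>

lemma anti_pencil_of_dominant_max:
  fixes A :: "nat set"
  assumes "finite A" "card A = n" "\<And>a. a \<in> A \<Longrightarrow> 0 < a" "1 < k" "k < n"
    and many: "((n - 1) choose k) \<le> num_k_divisors k A"
    and x: "x \<in> A" "\<Sum>A \<le> 2 * x"
  shows "anti_pencil k A"
proof -
  have small: "2 * \<Sum>B \<le> \<Sum>A" if "B \<in> k_divisors k A" for B
  proof -
    have B: "B \<subseteq> A" "card B = k" "\<Sum>B dvd \<Sum>A"
      using that by (auto simp: k_divisors_def is_divisor_def nsets_def)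
    moreover have "B \<noteq> A" using B(2) assms(2,5) by auto
    ultimately obtain y where y: "y \<in> A" "y \<notin> B" by blast
    have less: "\<Sum>B < \<Sum>A"
      using sum_strict_mono2[OF assms(1) B(1), of y "\<lambda>x. x"] y assms(3) by auto
    obtain m where m: "\<Sum>A = \<Sum>B * m" using B(3) by blast
    have "2 \<le> m"
    proof (rule ccontr)
      assume "\<not> 2 \<le> m"
      then have "m = 0 \<or> m = 1" by linarith
      then show False using m less by auto
    qed
    then show ?thesis unfolding m by (simp add: mult.commute)
  qed
  define a where "a = Max A"
  have a: "a \<in> A" "x \<le> a" unfolding a_def using x assms(1) by (auto intro: Max_in)
  have sub: "k_divisors k A \<subseteq> nsets (A - {a}) k"
  proof
    fix B assume B: "B \<in> k_divisors k A"
    then have BA: "B \<subseteq> A" "finite B" "card B = k" by (auto simp: k_divisors_def nsets_def)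
    have "a \<notin> B"
    proof
      assume "a \<in> B"
      have "card (B - {a}) = k - 1" using \<open>a \<in> B\<close> BA by simp
      then have "B - {a} \<noteq> {}" using assms(4) by (intro notI) simp
      then have "0 < \<Sum>(B - {a})" using BA assms(3) by (intro sum_pos) auto
      then have "a < \<Sum>B" using sum.remove[OF BA(2) \<open>a \<in> B\<close>, of "\<lambda>x. x"] by simp
      then show False using small[OF B] x a by simp
    qed
    then show "B \<in> nsets (A - {a}) k" using BA by (auto simp: nsets_def)
  qed
  have fin: "finite (nsets (A - {a}) k)" using assms(1) by (simp add: finite_imp_finite_nsets)
  have "card (nsets (A - {a}) k) = (n - 1) choose k"
    using card_nsets_diff[OF assms(1), of "{a}" k] a assms(2) by simp
  then have "card (nsets (A - {a}) k) \<le> card (k_divisors k A)"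
    using many by (simp add: num_k_divisors_def)
  then have "k_divisors k A = nsets (A - {a}) k"
    by (rule card_seteq[OF fin sub])
  then show ?thesis by (simp add: anti_pencil_def a_def)
qed

theorem theorem3:
  shows "finite {(k :: nat, n :: nat). 1 < k \<and> k < n \<and>
    \<not> (\<forall>A :: nat set. finite A \<longrightarrow> card A = n \<longrightarrow> (\<forall>a\<in>A. 0 < a) \<longrightarrow>
          num_k_divisors k A \<ge> ((n - 1) choose k) \<longrightarrow> anti_pencil k A)}"
    (is "finite ?X")
proof -
  define L :: nat where "L = 256000000000000"
  \<comment> \<open>The sum covers both regimes: \<open>L\<close> bounds n - k when n <= 20000 k,
    and 100000 covers small \<open>k\<close> as well as the + 1 of the cubic bound.\<close>
  define b where "b = 108 * L ^ 3 + 4 * L + 100000"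
  have "?X \<subseteq> {..b} \<times> {..b}"
  proof (rule subrelI)
    fix k n assume "(k, n) \<in> ?X"
    then obtain A :: "nat set" where k: "1 < k" "k < n"
      and A: "finite A" "card A = n" "\<forall>a\<in>A. 0 < a"
      and many: "((n - 1) choose k) \<le> num_k_divisors k A" and not: "\<not> anti_pencil k A"
      by auto
    \<comment> \<open>A counterexample has no dominant element, so it satisfies the assumptions of
      \<open>many_divisors\<close>.\<close>
    have half: "2 * x < \<Sum>A" if "x \<in> A" for x
    proof (rule ccontr)
      assume "\<not> ?thesis"
      then show False using anti_pencil_of_dominant_max[of A n k x] A k many not that by auto
    qed
    interpret many_divisors A k n "\<Sum>A"
      using k A many half by unfold_locales (auto simp: num_k_divisors_def)
    have "n \<le> b"
    proof (cases "20000 * k < n")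
      case True
      then show ?thesis using bounded_of_small_k by (simp add: b_def)
    next
      case False
      then have l: "n - k \<le> L" using codegree_bounded by (simp add: L_def)
      then have "(n - k) ^ 3 \<le> L ^ 3" by (intro power_mono) auto
      then show ?thesis using bounded_by_codegree l unfolding b_def by linarith
    qed
    then show "(k, n) \<in> {..b} \<times> {..b}" using k by simp
  qed
  then show ?thesis by (rule finite_subset) simp
qed

end
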